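(* Let $1\le p<\infty$, $\omega\in\mathcal{A}_p(\mathbb{Z})$ and $x\in l^1_\omega$. For every $t>0$, there exist a constant $C$ only depending on $p$ and a sequence of disjoint intervals $\mathcal{I}_t=\mathcal{I}_t(x,\omega)$, consisting of those maximal dyadic intervals over which the average of $|x|$ relative to $\omega$ is greater than $t$ (that is, the dyadic intervals that are maximal with respect to inclusion among the dyadic intervals $I$ satisfying $\frac1{\omega(I)}\sum_{k\in I}|x(k)|\omega(k)>t$), such that: (i) $t<\frac{1}{\omega(I)}\sum_{k\in I}|x(k)|\omega(k)\le Ct$ for every $I\in\mathcal{I}_t$; (ii) $|x(n)|\le t$ for every $n\notin\bigcup_{I\in\mathcal{I}_t}I$; (iii) if $t_1>t_2$, then every dyadic interval in $\mathcal{I}_{t_1}$ is a subinterval of some dyadic interval in $\mathcal{I}_{t_2}$.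
   Context: A discrete weight on $\mathbb{Z}$ is a sequence $\omega=\{\omega(k)\}_{k\in\mathbb{Z}}$ of positive real numbers; for a finite set $I\subset\mathbb{Z}$, $\omega(I):=\sum_{k\in I}\omega(k)$. An interval $J\subset\mathbb{Z}$ is a nonempty finite set of consecutive integers, and $|J|$ is its cardinality. With $\mathbb{N}=\{0,1,2,\dots\}$, the dyadic intervals are the sets $I_{N,j}=\{(j-1)2^N+1,\dots,j2^N\}$, $N\in\mathbb{N}$, $j\in\mathbb{Z}$. A discrete weight $\omega$ belongs to $\mathcal{A}_1(\mathbb{Z})$ if $\|\omega\|_{\mathcal{A}_1(\mathbb{Z})}:=\sup_{J}\frac1{|J|}\big(\frac{1}{\inf_{k\in J}\omega(k)}\sum_{k\in J}\omega(k)\big)<\infty$, and for $1<p<\infty$ it belongs to $\mathcal{A}_p(\mathbb{Z})$ if $$\|\omega\|_{\mathcal{A}_p(\mathbb{Z})}:=\sup_{J}\Big(\frac1{|J|}\sum_{k\in J}\omega(k)\Big)\Big(\frac1{|J|}\sum_{k\in J}\omega(k)^{-\frac1{p-1}}\Big)^{p-1}<\infty,$$ the suprema being over all intervals $J\subset\mathbb{Z}$. $l^1_\omega$ is the space of real sequences $x=\{x(k)\}_{k\in\mathbb{Z}}$ with $\sum_{k\in\mathbb{Z}}|x(k)|\omega(k)<\infty$. In (iii), $t_1$ and $t_2$ are positive numbers.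
   Formalization: The constant C in (i) depends on p and on the A_p norm of ω rather than on p alone; with p alone the claim fails (take ω(2)=M, ω=1 elsewhere, x=(1+M)t at 1 and 0 elsewhere: then {1} is maximal with average (1+M)t). *)

theory Defs
  imports "HOL-Analysis.Analysis"
begin

definition discrete_weight :: "(int \<Rightarrow> real) \<Rightarrow> bool" where
  "discrete_weight \<omega> \<longleftrightarrow> (\<forall>k. 0 < \<omega> k)"

definition intervals :: "int set set" where
  "intervals = {{a..b} | a b. a \<le> b}"

definition dyadic_interval :: "nat \<Rightarrow> int \<Rightarrow> int set" where
  "dyadic_interval N j = {(j - 1) * 2 ^ N + 1 .. j * 2 ^ N}"

definition dyadic_intervals :: "int set set" where
  "dyadic_intervals = {dyadic_interval N j | N j. True}"

text \<open>The suprema are taken in the extended reals, so that they may be infinite. The second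
  formula is intended for \<open>1 < p\<close>; its value for \<open>p < 1\<close> is irrelevant.\<close>

definition Ap_norm :: "real \<Rightarrow> (int \<Rightarrow> real) \<Rightarrow> ereal" where
  "Ap_norm p \<omega> =
    (if p = 1 then
       (SUP J\<in>intervals. ereal (1 / real (card J) * (1 / (INF k\<in>J. \<omega> k) * (\<Sum>k\<in>J. \<omega> k))))
     else
       (SUP J\<in>intervals. ereal (1 / real (card J) * (\<Sum>k\<in>J. \<omega> k) *
          (1 / real (card J) * (\<Sum>k\<in>J. \<omega> k powr (- (1 / (p - 1))))) powr (p - 1))))"

definition Ap_weights :: "real \<Rightarrow> (int \<Rightarrow> real) set" where
  "Ap_weights p = {\<omega>. discrete_weight \<omega> \<and> Ap_norm p \<omega> < \<infinity>}"

definition weighted_l1 :: "(int \<Rightarrow> real) \<Rightarrow> (int \<Rightarrow> real) set" where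
  "weighted_l1 \<omega> = {x. (\<lambda>k. \<bar>x k\<bar> * \<omega> k) summable_on UNIV}"

definition weighted_avg :: "(int \<Rightarrow> real) \<Rightarrow> (int \<Rightarrow> real) \<Rightarrow> int set \<Rightarrow> real" where
  "weighted_avg \<omega> x I = 1 / (\<Sum>k\<in>I. \<omega> k) * (\<Sum>k\<in>I. \<bar>x k\<bar> * \<omega> k)"

definition large_dyadic :: "(int \<Rightarrow> real) \<Rightarrow> (int \<Rightarrow> real) \<Rightarrow> real \<Rightarrow> int set set" where
  "large_dyadic x \<omega> t = {I \<in> dyadic_intervals. t < weighted_avg \<omega> x I}"

definition maximal_dyadic :: "(int \<Rightarrow> real) \<Rightarrow> (int \<Rightarrow> real) \<Rightarrow> real \<Rightarrow> int set set" where
  "maximal_dyadic x \<omega> t =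
    {I \<in> large_dyadic x \<omega> t. \<forall>J \<in> large_dyadic x \<omega> t. I \<subseteq> J \<longrightarrow> J = I}"

end

theory Submission imports Defs begin

text \<open>The $A_p$ condition makes the weight doubling: a dyadic interval has weight at most
  \<open>D = 2\<^sup>p \<parallel>\<omega>\<parallel>\<close> times the weight of either of its halves. Applied to the half that contains a given
  point, this bounds the average over a maximal interval by \<open>D\<close> times the average over its parent,
  which is at most \<open>t\<close>. Applied to the other half, it shows that the weights of the dyadic ancestors
  of a point grow at least geometrically with ratio \<open>1 + 1/D\<close>; as \<open>\<Sum>\<bar>x\<bar>\<omega>\<close> is finite, only finitely
  many ancestors have average above \<open>t\<close>, so each of these lies in a maximal one.\<close>

section \<open>Dyadic intervals\<close>

lemma int_div_eq_iff:
  fixes i q b :: int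
  assumes "0 < b"
  shows "i div b = q \<longleftrightarrow> q * b \<le> i \<and> i < q * b + b"
proof
  assume q: "i div b = q"
  have "i = q * b + i mod b" using div_mult_mod_eq[of i b] q by simp
  thus "q * b \<le> i \<and> i < q * b + b"
    using pos_mod_bound[OF assms, of i] pos_mod_sign[OF assms, of i] by linarith
next
  assume "q * b \<le> i \<and> i < q * b + b"
  thus "i div b = q"
    using int_div_pos_eq[of i b q "i - q * b"] by (simp add: mult.commute)
qed

text \<open>Level \<open>N\<close> intervals start one past a multiple of \<open>2 ^ N\<close>, so
  after shifting by 1 membership is integer division. As \<open>k\<close> determines the index, each
  level partitions the integers.\<close>

lemma mem_dyadic_interval_iff:
  "k \<in> dyadic_interval N j \<longleftrightarrow> j = (k - 1) div 2 ^ N + 1"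
proof -
  have "k \<in> dyadic_interval N j \<longleftrightarrow> (j - 1) * 2 ^ N \<le> k - 1 \<and> k - 1 < (j - 1) * 2 ^ N + 2 ^ N"
    by (simp add: dyadic_interval_def left_diff_distrib) linarith
  also have "\<dots> \<longleftrightarrow> (k - 1) div 2 ^ N = j - 1"
    by (rule int_div_eq_iff[symmetric]) simp
  finally show ?thesis by auto
qed

text \<open>Fixing a point \<open>k\<close> turns the dyadic intervals around it into a chain
  indexed by the level, on which growth and maximality can be argued by natural numbers.\<close>

definition dyadic_ancestor :: "int \<Rightarrow> nat \<Rightarrow> int set" where
  "dyadic_ancestor k N = dyadic_interval N ((k - 1) div 2 ^ N + 1)"

lemma self_in_dyadic_ancestor: "k \<in> dyadic_ancestor k N"
  by (simp add: dyadic_ancestor_def mem_dyadic_interval_iff)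

lemma dyadic_ancestor_in: "dyadic_ancestor k N \<in> dyadic_intervals"
  by (auto simp: dyadic_ancestor_def dyadic_intervals_def)

lemma dyadic_ancestor_eqI: "k \<in> dyadic_interval N j \<Longrightarrow> dyadic_interval N j = dyadic_ancestor k N"
  by (simp add: dyadic_ancestor_def mem_dyadic_interval_iff)

lemma dyadic_containingE:
  assumes "I \<in> dyadic_intervals" "k \<in> I"
  obtains N where "I = dyadic_ancestor k N"
  using assms dyadic_ancestor_eqI unfolding dyadic_intervals_def by blast

text \<open>The quotient by \<open>2 ^ N\<close> determines the quotient by the larger power
  \<open>2 ^ M\<close>.\<close>

lemma dyadic_ancestor_mono:
  assumes "N \<le> M"
  shows "dyadic_ancestor k N \<subseteq> dyadic_ancestor k M"
proof
  fix l assume "l \<in> dyadic_ancestor k N"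
  hence eq: "(k - 1) div 2 ^ N = (l - 1) div 2 ^ N"
    by (simp add: dyadic_ancestor_def mem_dyadic_interval_iff)
  have "i div 2 ^ M = i div 2 ^ N div 2 ^ (M - N)" for i :: int
    using assms by (simp flip: zdiv_zmult2_eq power_add)
  with eq show "l \<in> dyadic_ancestor k M"
    by (simp add: dyadic_ancestor_def mem_dyadic_interval_iff)
qed

lemma dyadic_interval_nonempty: "I \<in> dyadic_intervals \<Longrightarrow> I \<noteq> {}"
  by (auto simp: dyadic_intervals_def dyadic_interval_def left_diff_distrib)

lemma finite_dyadic_interval: "finite (dyadic_interval N j)"
  by (simp add: dyadic_interval_def)

lemma finite_dyadic_ancestor: "finite (dyadic_ancestor k N)"
  by (simp add: dyadic_ancestor_def finite_dyadic_interval)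

lemma card_dyadic_interval: "card (dyadic_interval N j) = 2 ^ N"
proof -
  have "j * 2 ^ N + 1 - ((j - 1) * 2 ^ N + 1) = (2::int) ^ N"
    by (simp add: algebra_simps)
  thus ?thesis
    by (simp add: dyadic_interval_def nat_power_eq)
qed

lemma dyadic_interval_in_intervals: "dyadic_interval N j \<in> intervals"
proof -
  have "(j - 1) * 2 ^ N + 1 \<le> j * 2 ^ N" by (simp add: algebra_simps)
  thus ?thesis unfolding intervals_def dyadic_interval_def by blast
qed

lemma countable_dyadic_intervals: "countable dyadic_intervals"
proof -
  have "dyadic_intervals = range (\<lambda>(N, j). dyadic_interval N j)"
    by (auto simp: dyadic_intervals_def)
  thus ?thesis by (metis countable_image countableI_type)
qed

text \<open>The halves of the parent with index \<open>e\<close> have indices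
  \<open>2 * e - 1\<close> and \<open>2 * e\<close>. One of them is the ancestor of
  \<open>k\<close>, according to the parity of its quotient, and \<open>H\<close> is its
  sibling.\<close>

lemma dyadic_ancestor_split:
  obtains H where "dyadic_ancestor k (Suc N) = dyadic_ancestor k N \<union> H"
    "dyadic_ancestor k N \<inter> H = {}" "H \<in> range (dyadic_interval N)"
proof -
  define e where "e = (k - 1) div 2 ^ Suc N + 1"
  have e: "e = (k - 1) div 2 ^ N div 2 + 1"
    by (simp add: e_def zdiv_zmult2_eq[symmetric] mult.commute)
  have split: "dyadic_ancestor k (Suc N) = dyadic_interval N (2 * e - 1) \<union> dyadic_interval N (2 * e)"
    unfolding dyadic_ancestor_def e_def[symmetric]
    by (auto simp: dyadic_interval_def algebra_simps)
  have disj: "dyadic_interval N (2 * e - 1) \<inter> dyadic_interval N (2 * e) = {}"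
    by (auto simp: dyadic_interval_def algebra_simps)
  have halves: "d + 1 = 2 * (d div 2 + 1) - 1 \<or> d + 1 = 2 * (d div 2 + 1)" for d :: int
    by presburger
  have "(k - 1) div 2 ^ N + 1 = 2 * e - 1 \<or> (k - 1) div 2 ^ N + 1 = 2 * e"
    unfolding e by (rule halves)
  hence "dyadic_ancestor k N = dyadic_interval N (2 * e - 1) \<or> dyadic_ancestor k N = dyadic_interval N (2 * e)"
    unfolding dyadic_ancestor_def by metis
  thus ?thesis
    using that split disj by (metis Int_commute Un_commute rangeI)
qed

section \<open>The doubling property\<close>

text \<open>The convex function y^(-a) lies above its tangent at y = 1.\<close>

lemma powr_neg_tangent:
  fixes a y :: real
  assumes "0 \<le> a" "0 < y"
  shows "1 - a * (y - 1) \<le> y powr (- a)"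
proof -
  have "1 - a * (y - 1) \<le> 1 - a * ln y"
    using assms ln_le_minus_one[of y] by (simp add: mult_left_mono)
  also have "\<dots> \<le> exp (- a * ln y)"
    using exp_ge_add_one_self[of "- a * ln y"] by simp
  finally show ?thesis using assms by (simp add: powr_def)
qed

text \<open>Jensen's inequality for the convex function y^(-a): sum the tangent bound over the
  values \<open>w k / m\<close>, whose mean is 1, so that the linear terms cancel.\<close>

lemma sum_powr_neg_ge:
  fixes w :: "'a \<Rightarrow> real"
  assumes "finite E" "E \<noteq> {}" "\<And>k. k \<in> E \<Longrightarrow> 0 < w k" "0 \<le> a"
  defines "m \<equiv> sum w E / card E"
  shows "card E * m powr (- a) \<le> (\<Sum>k\<in>E. w k powr (- a))"
proof -
  have "0 < sum w E" using assms by (intro sum_pos) auto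
  have c: "0 < real (card E)" using assms by (simp add: card_gt_0_iff)
  have m: "0 < m" unfolding m_def using \<open>0 < sum w E\<close> c by simp
  have "(\<Sum>k\<in>E. w k / m) = card E"
    unfolding sum_divide_distrib[symmetric] using \<open>0 < sum w E\<close> c by (simp add: m_def)
  hence "real (card E) = (\<Sum>k\<in>E. 1 - a * (w k / m - 1))"
    by (simp add: sum_subtractf flip: sum_distrib_left)
  also have "\<dots> \<le> (\<Sum>k\<in>E. (w k / m) powr (- a))"
    using assms(3,4) m by (intro sum_mono powr_neg_tangent divide_pos_pos)
  also have "\<dots> = (\<Sum>k\<in>E. w k powr (- a)) / m powr (- a)"
    using m assms(3) by (subst sum_divide_distrib) (simp add: powr_divide less_imp_le)
  finally show ?thesis using m by (simp only: pos_le_divide_eq powr_gt_zero)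
qed

section \<open>From the A_p condition to doubling\<close>

lemma Ap_norm_ge:
  assumes "J \<in> intervals" "p \<noteq> 1"
  shows "ereal (1 / real (card J) * (\<Sum>k\<in>J. \<omega> k) *
          (1 / real (card J) * (\<Sum>k\<in>J. \<omega> k powr (- (1 / (p - 1))))) powr (p - 1)) \<le> Ap_norm p \<omega>"
  using assms by (auto simp: Ap_norm_def intro: SUP_upper)

lemma A1_norm_ge:
  assumes "J \<in> intervals"
  shows "ereal (1 / real (card J) * (1 / (INF k\<in>J. \<omega> k) * (\<Sum>k\<in>J. \<omega> k))) \<le> Ap_norm 1 \<omega>"
  using assms by (auto simp: Ap_norm_def intro: SUP_upper)

text \<open>The A_p condition is tested on \<open>J\<close> alone. Its second factor is bounded
  below through \<open>E\<close>: for p = 1 by comparing the infimum over \<open>J\<close> with the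
  mean over \<open>E\<close>, for p > 1 by restricting the dual sum to \<open>E\<close> and applying
  Jensen.\<close>

lemma doubling_halves:
  assumes p: "1 \<le> p" and \<omega>: "\<omega> \<in> Ap_weights p"
    and J: "J \<in> intervals" "finite J" and E: "E \<subseteq> J" "E \<noteq> {}" "card J = 2 * card E"
  shows "sum \<omega> J \<le> 2 powr p * real_of_ereal (Ap_norm p \<omega>) * sum \<omega> E"
proof -
  define K where "K = real_of_ereal (Ap_norm p \<omega>)"
  have pos: "0 < \<omega> k" for k using \<omega> by (auto simp: Ap_weights_def discrete_weight_def)
  have fin: "Ap_norm p \<omega> < \<infinity>" using \<omega> by (auto simp: Ap_weights_def)
  \<comment> \<open>The norm is finite here: plus infinity is excluded by \<open>fin\<close>, and
    minus infinity bounds no real from above.\<close>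
  have le_K: "r \<le> K" if "ereal r \<le> Ap_norm p \<omega>" for r
    using that fin unfolding K_def by (cases "Ap_norm p \<omega>") auto
  have finE: "finite E" using J E by (rule_tac finite_subset)
  have c: "0 < real (card E)" using finE E by (simp add: card_gt_0_iff)
  have sE: "0 < sum \<omega> E" using finE E pos by (intro sum_pos) auto
  have sJ: "0 < sum \<omega> J" using J E pos by (intro sum_pos) auto
  show ?thesis
  proof (cases "p = 1")
    case True
    define i where "i = (INF k\<in>J. \<omega> k)"
    \<comment> \<open>The infimum over a finite set is attained, hence positive.\<close>
    have "i \<in> \<omega> ` J"
      unfolding i_def using J E Min_in[of "\<omega> ` J"] by (subst cInf_eq_Min) blast+
    hence i0: "0 < i" using pos by auto
    have "i \<le> \<omega> k" if "k \<in> E" for k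
      unfolding i_def using that J E by (intro cINF_lower bdd_below_finite finite_imageI) auto
    hence i_le: "card E * i \<le> sum \<omega> E"
      using sum_mono[of E "\<lambda>_. i" \<omega>] by simp
    have "1 / real (card J) * (1 / i * sum \<omega> J) \<le> K"
      using le_K A1_norm_ge[OF J(1), of \<omega>] True unfolding i_def by simp
    hence *: "sum \<omega> J \<le> 2 * K * (card E * i)"
      using c i0 E by (simp add: field_simps)
    \<comment> \<open>The sign of \<open>K\<close> is needed before \<open>i_le\<close> can be
      multiplied by it.\<close>
    hence "0 < 2 * K * (card E * i)" using sJ by linarith
    hence "0 < K" using mult_pos_pos[OF c i0] by (simp add: zero_less_mult_iff[of "2 * K"])
    hence "2 * K * (card E * i) \<le> 2 * K * sum \<omega> E"
      using i_le by (intro mult_left_mono) auto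
    with * True show ?thesis unfolding K_def by simp
  next
    case False
    hence p1: "0 < p - 1" using p by simp
    define a where "a = 1 / (p - 1)"
    define m where "m = sum \<omega> E / card E"
    have a: "0 \<le> a" "a * (p - 1) = 1" using p1 by (auto simp: a_def)
    have m: "0 < m" unfolding m_def using c sE by simp
    have "card E * m powr (- a) \<le> (\<Sum>k\<in>E. \<omega> k powr (- a))"
      unfolding m_def using finE E pos a by (intro sum_powr_neg_ge) auto
    also have "\<dots> \<le> (\<Sum>k\<in>J. \<omega> k powr (- a))"
      using J E by (intro sum_mono2) auto
    finally have "m powr (- a) / 2 \<le> 1 / real (card J) * (\<Sum>k\<in>J. \<omega> k powr (- a))"
      using c E by (simp add: field_simps)
    hence "(m powr (- a) / 2) powr (p - 1)
        \<le> (1 / real (card J) * (\<Sum>k\<in>J. \<omega> k powr (- a))) powr (p - 1)"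
      using p1 by (intro powr_mono2) auto
    \<comment> \<open>Since \<open>a * (p - 1) = 1\<close>, the power is 1 / (2^(p-1) m). The 2 kept
      in the numerator later cancels against \<open>card J = 2 * card E\<close>, and
      \<open>card E * m\<close> is the weight of \<open>E\<close>.\<close>
    moreover have "(m powr (- a) / 2) powr (p - 1) = 2 / (2 powr p * m)"
    proof -
      have "(m powr (- a) / 2) powr (p - 1) = m powr (- (a * (p - 1))) / 2 powr (p - 1)"
        using m by (simp only: powr_divide powr_powr mult_minus_left)
      also have "\<dots> = (1 / m) / (2 powr p / 2)"
        using m unfolding a(2) by (simp add: powr_minus_divide powr_diff)
      finally show ?thesis by (simp add: mult.commute)
    qed
    ultimately have "1 / real (card J) * sum \<omega> J * (2 / (2 powr p * m))
        \<le> 1 / real (card J) * sum \<omega> J * (1 / real (card J) * (\<Sum>k\<in>J. \<omega> k powr (- a))) powr (p - 1)"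
      using sJ by (intro mult_left_mono) auto
    also have "\<dots> \<le> K"
      using le_K[OF Ap_norm_ge[OF J(1) False]] unfolding a_def .
    finally have "1 / real (card J) * sum \<omega> J * (2 / (2 powr p * m)) \<le> K" .
    moreover have "1 / real (card J) * sum \<omega> J * (2 / (2 powr p * m)) = sum \<omega> J / (2 powr p * sum \<omega> E)"
      unfolding m_def using c sE E by (simp add: field_simps)
    ultimately have "sum \<omega> J / (2 powr p * sum \<omega> E) \<le> K" by simp
    thus ?thesis using sE unfolding K_def by (simp add: field_simps)
  qed
qed

text \<open>Both halves of the parent are covered: the one containing \<open>k\<close> serves the
  upper bound on averages, its sibling the growth of weights.\<close>

definition dyadic_doubling :: "real \<Rightarrow> (int \<Rightarrow> real) \<Rightarrow> bool" where
  "dyadic_doubling D \<omega> \<longleftrightarrow> (\<forall>k N j. dyadic_interval N j \<subseteq> dyadic_ancestor k (Suc N) \<longrightarrow>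
     sum \<omega> (dyadic_ancestor k (Suc N)) \<le> D * sum \<omega> (dyadic_interval N j))"

lemma Ap_imp_dyadic_doubling:
  assumes "1 \<le> p" "\<omega> \<in> Ap_weights p"
  shows "dyadic_doubling (2 powr p * real_of_ereal (Ap_norm p \<omega>)) \<omega>"
  unfolding dyadic_doubling_def
proof (intro allI impI)
  fix k N j assume sub: "dyadic_interval N j \<subseteq> dyadic_ancestor k (Suc N)"
  have "dyadic_interval N j \<noteq> {}"
    using dyadic_interval_nonempty by (auto simp: dyadic_intervals_def)
  with sub show "sum \<omega> (dyadic_ancestor k (Suc N))
      \<le> 2 powr p * real_of_ereal (Ap_norm p \<omega>) * sum \<omega> (dyadic_interval N j)"
    by (intro doubling_halves assms)
       (auto simp: dyadic_ancestor_def dyadic_interval_in_intervals finite_dyadic_interval card_dyadic_interval)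
qed

section \<open>Weights along the chain of ancestors\<close>

lemma dyadic_doubling_parent:
  "dyadic_doubling D \<omega> \<Longrightarrow>
    sum \<omega> (dyadic_ancestor k (Suc N)) \<le> D * sum \<omega> (dyadic_ancestor k N)"
  using dyadic_ancestor_mono[of N "Suc N" k]
  by (auto simp: dyadic_doubling_def dyadic_ancestor_def[of k N])

lemma sum_dyadic_ancestor_pos:
  "discrete_weight \<omega> \<Longrightarrow> 0 < sum \<omega> (dyadic_ancestor k N)"
  using self_in_dyadic_ancestor[of k N]
  by (intro sum_pos finite_dyadic_ancestor) (auto simp: discrete_weight_def)

lemma dyadic_doubling_pos:
  assumes "discrete_weight \<omega>" "dyadic_doubling D \<omega>"
  shows "0 < D"
proof -
  have "0 < D * sum \<omega> (dyadic_ancestor 0 0)"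
    using sum_dyadic_ancestor_pos[OF assms(1)] dyadic_doubling_parent[OF assms(2)] by (rule less_le_trans)
  thus ?thesis
    using sum_dyadic_ancestor_pos[OF assms(1), of 0 0] by (simp add: zero_less_mult_iff)
qed

text \<open>At each step the sibling \<open>H\<close> contributes at least 1/D of the parent's
  weight, hence at least 1/D of the current weight.\<close>

lemma sum_dyadic_ancestor_growth:
  assumes w: "discrete_weight \<omega>" and D: "dyadic_doubling D \<omega>"
  shows "(1 + 1 / D) ^ N * sum \<omega> (dyadic_ancestor k 0) \<le> sum \<omega> (dyadic_ancestor k N)"
proof (induction N)
  case 0
  show ?case by simp
next
  case (Suc N)
  note D0 = dyadic_doubling_pos[OF w D]
  obtain H where H: "dyadic_ancestor k (Suc N) = dyadic_ancestor k N \<union> H"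
    "dyadic_ancestor k N \<inter> H = {}" "H \<in> range (dyadic_interval N)"
    by (rule dyadic_ancestor_split)
  have sum_eq: "sum \<omega> (dyadic_ancestor k (Suc N)) = sum \<omega> (dyadic_ancestor k N) + sum \<omega> H"
    using H by (auto simp: finite_dyadic_ancestor finite_dyadic_interval intro!: sum.union_disjoint)
  have "sum \<omega> H \<ge> 0"
    using w by (intro sum_nonneg) (auto simp: discrete_weight_def less_imp_le)
  hence "sum \<omega> (dyadic_ancestor k N) \<le> sum \<omega> (dyadic_ancestor k (Suc N))" using sum_eq by simp
  also have "\<dots> \<le> D * sum \<omega> H"
    using D H unfolding dyadic_doubling_def by blast
  finally have "sum \<omega> (dyadic_ancestor k N) / D \<le> sum \<omega> H" using D0 by (simp add: field_simps)
  hence "(1 + 1 / D) * sum \<omega> (dyadic_ancestor k N) \<le> sum \<omega> (dyadic_ancestor k (Suc N))"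
    using sum_eq by (simp add: algebra_simps)
  moreover have "(1 + 1 / D) * ((1 + 1 / D) ^ N * sum \<omega> (dyadic_ancestor k 0))
      \<le> (1 + 1 / D) * sum \<omega> (dyadic_ancestor k N)"
    using D0 Suc by (intro mult_left_mono) auto
  ultimately show ?case by (simp add: mult.assoc)
qed

section \<open>Maximal intervals\<close>

lemma finite_large_ancestors:
  assumes w: "discrete_weight \<omega>" and D: "dyadic_doubling D \<omega>"
    and x: "x \<in> weighted_l1 \<omega>" and t: "0 < t"
  shows "finite {N. t < weighted_avg \<omega> x (dyadic_ancestor k N)}"
proof -
  define S where "S = (\<Sum>\<^sub>\<infinity>k. \<bar>x k\<bar> * \<omega> k)"
  define s0 where "s0 = sum \<omega> (dyadic_ancestor k 0)"
  have s0: "0 < s0" unfolding s0_def by (rule sum_dyadic_ancestor_pos[OF w])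
  have le_S: "(\<Sum>k\<in>F. \<bar>x k\<bar> * \<omega> k) \<le> S" if "finite F" for F
    unfolding S_def using x w that
    by (intro finite_sum_le_infsum) (auto simp: weighted_l1_def discrete_weight_def less_imp_le)
  \<comment> \<open>From level \<open>M\<close> on, \<open>t\<close> times the weight of the
    ancestor exceeds the total \<open>S\<close>, so no average there can exceed
    \<open>t\<close>.\<close>
  obtain M where M: "S / (t * s0) < (1 + 1 / D) ^ M"
    using real_arch_pow[of "1 + 1 / D"] dyadic_doubling_pos[OF w D] by auto
  have "N < M" if "t < weighted_avg \<omega> x (dyadic_ancestor k N)" for N
  proof (rule ccontr)
    assume "\<not> N < M"
    let ?s = "sum \<omega> (dyadic_ancestor k N)"
    have "t * ?s < (\<Sum>k\<in>dyadic_ancestor k N. \<bar>x k\<bar> * \<omega> k)"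
      using that sum_dyadic_ancestor_pos[OF w, of k N] by (simp add: weighted_avg_def field_simps)
    also have "\<dots> \<le> S" by (intro le_S finite_dyadic_ancestor)
    also have "S < (1 + 1 / D) ^ M * s0 * t" using M s0 t by (simp add: field_simps)
    also have "\<dots> \<le> (1 + 1 / D) ^ N * s0 * t"
      using \<open>\<not> N < M\<close> s0 t dyadic_doubling_pos[OF w D]
      by (intro mult_right_mono power_increasing) auto
    also have "\<dots> \<le> ?s * t"
      using sum_dyadic_ancestor_growth[OF w D, of N k] t unfolding s0_def by (intro mult_right_mono) auto
    finally show False by (simp add: mult.commute)
  qed
  thus ?thesis by (rule_tac finite_subset[of _ "{..<M}"]) auto
qed

text \<open>Fix a point \<open>k\<close> of \<open>I\<close>. Every large interval containing
  \<open>I\<close> is an ancestor of \<open>k\<close> with level in the finite set \<open>A\<close>,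
  so the ancestor of level \<open>Max A\<close> is maximal.\<close>

lemma large_dyadic_subset_maximal:
  assumes "discrete_weight \<omega>" "dyadic_doubling D \<omega>" "x \<in> weighted_l1 \<omega>" "0 < t"
    and I: "I \<in> large_dyadic x \<omega> t"
  obtains J where "J \<in> maximal_dyadic x \<omega> t" "I \<subseteq> J"
proof -
  have "I \<in> dyadic_intervals" using I by (simp add: large_dyadic_def)
  then obtain k where k: "k \<in> I" using dyadic_interval_nonempty by blast
  then obtain N where N: "I = dyadic_ancestor k N"
    using \<open>I \<in> dyadic_intervals\<close> by (rule_tac dyadic_containingE)
  define A where "A = {N. t < weighted_avg \<omega> x (dyadic_ancestor k N)}"
  have fin: "finite A" unfolding A_def using assms by (intro finite_large_ancestors)
  have NA: "N \<in> A" using I N by (simp add: A_def large_dyadic_def)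
  define J where "J = dyadic_ancestor k (Max A)"
  have "Max A \<in> A" using fin NA by (intro Max_in) auto
  hence JL: "J \<in> large_dyadic x \<omega> t"
    by (simp add: J_def A_def large_dyadic_def dyadic_ancestor_in)
  have IJ: "I \<subseteq> J" unfolding N J_def using fin NA by (intro dyadic_ancestor_mono Max_ge)
  have "J' \<subseteq> J" if J': "J' \<in> large_dyadic x \<omega> t" "J \<subseteq> J'" for J'
  proof -
    have "J' \<in> dyadic_intervals" "k \<in> J'" using J' IJ k by (auto simp: large_dyadic_def)
    then obtain M where M: "J' = dyadic_ancestor k M" by (rule dyadic_containingE)
    hence "M \<in> A" using J' by (simp add: A_def large_dyadic_def)
    thus ?thesis unfolding M J_def using fin by (intro dyadic_ancestor_mono Max_ge)
  qed
  hence "J \<in> maximal_dyadic x \<omega> t" using JL by (auto simp: maximal_dyadic_def)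
  thus ?thesis using IJ that by blast
qed

text \<open>Two dyadic intervals with a common point lie in the chain of that point, so one contains
  the other and maximality makes them equal.\<close>

lemma disjoint_maximal_dyadic: "disjoint (maximal_dyadic x \<omega> t)"
proof (rule disjointI)
  fix I J assume IJ: "I \<in> maximal_dyadic x \<omega> t" "J \<in> maximal_dyadic x \<omega> t" "I \<noteq> J"
  show "I \<inter> J = {}"
  proof (rule ccontr)
    assume "I \<inter> J \<noteq> {}"
    then obtain k where k: "k \<in> I" "k \<in> J" by blast
    have "I \<in> dyadic_intervals" "J \<in> dyadic_intervals"
      using IJ by (auto simp: maximal_dyadic_def large_dyadic_def)
    then obtain N M where "I = dyadic_ancestor k N" "J = dyadic_ancestor k M"
      using k by (metis dyadic_containingE)
    hence "I \<subseteq> J \<or> J \<subseteq> I" using dyadic_ancestor_mono linear by metis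
    thus False using IJ by (auto simp: maximal_dyadic_def)
  qed
qed

lemma dyadic_ancestor_Suc_neq: "dyadic_ancestor k (Suc N) \<noteq> dyadic_ancestor k N"
proof
  assume "dyadic_ancestor k (Suc N) = dyadic_ancestor k N"
  hence "card (dyadic_ancestor k (Suc N)) = card (dyadic_ancestor k N)" by simp
  thus False by (simp add: dyadic_ancestor_def card_dyadic_interval)
qed

lemma weighted_avg_maximal_le:
  assumes w: "discrete_weight \<omega>" and D: "dyadic_doubling D \<omega>" and t: "0 < t"
    and I: "I \<in> maximal_dyadic x \<omega> t"
  shows "weighted_avg \<omega> x I \<le> D * t"
proof -
  have "I \<in> dyadic_intervals" using I by (simp add: maximal_dyadic_def large_dyadic_def)
  then obtain k where "k \<in> I" using dyadic_interval_nonempty by blast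
  then obtain N where N: "I = dyadic_ancestor k N"
    using \<open>I \<in> dyadic_intervals\<close> by (rule_tac dyadic_containingE)
  define P where "P = dyadic_ancestor k (Suc N)"
  have sub: "I \<subseteq> P" unfolding N P_def by (intro dyadic_ancestor_mono) simp
  \<comment> \<open>The parent strictly contains \<open>I\<close>, so maximality forbids it to be
    large.\<close>
  have "P \<notin> large_dyadic x \<omega> t"
    using I sub dyadic_ancestor_Suc_neq[of k N] unfolding N P_def by (auto simp: maximal_dyadic_def)
  hence avg: "weighted_avg \<omega> x P \<le> t"
    by (auto simp: large_dyadic_def P_def dyadic_ancestor_in)
  have sI: "0 < sum \<omega> I" and sP: "0 < sum \<omega> P"
    unfolding N P_def by (rule sum_dyadic_ancestor_pos[OF w])+
  have "(\<Sum>k\<in>I. \<bar>x k\<bar> * \<omega> k) \<le> (\<Sum>k\<in>P. \<bar>x k\<bar> * \<omega> k)"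
    using sub w by (intro sum_mono2)
      (auto simp: P_def finite_dyadic_ancestor discrete_weight_def less_imp_le)
  also have "\<dots> \<le> t * sum \<omega> P" using avg sP by (simp add: weighted_avg_def field_simps)
  also have "\<dots> \<le> t * (D * sum \<omega> I)"
    using dyadic_doubling_parent[OF D, of k N] t unfolding N P_def by simp
  finally show ?thesis using sI by (simp add: weighted_avg_def field_simps)
qed

text \<open>The singleton of \<open>n\<close> is dyadic of level 0 with average |x n|; were this
  above \<open>t\<close>, a maximal interval would contain \<open>n\<close>.\<close>

lemma abs_le_outside_maximal:
  assumes "discrete_weight \<omega>" "dyadic_doubling D \<omega>" "x \<in> weighted_l1 \<omega>" "0 < t"
    and n: "n \<notin> \<Union> (maximal_dyadic x \<omega> t)"
  shows "\<bar>x n\<bar> \<le> t"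
proof (rule ccontr)
  assume "\<not> \<bar>x n\<bar> \<le> t"
  moreover have "dyadic_ancestor n 0 = {n}"
    by (auto simp: dyadic_ancestor_def dyadic_interval_def)
  moreover have "\<omega> n \<noteq> 0" using assms(1) by (simp add: discrete_weight_def less_imp_neq[symmetric])
  ultimately have "dyadic_ancestor n 0 \<in> large_dyadic x \<omega> t"
    using dyadic_ancestor_in[of n 0] by (simp add: large_dyadic_def weighted_avg_def)
  thus False
    using large_dyadic_subset_maximal assms self_in_dyadic_ancestor by (metis UnionI subsetD)
qed

text \<open>\<open>C\<close> is a function of the A_p norm, fixed before the weight. Dependence on p
  alone is impossible: let the weight be B at 1 and 1 elsewhere, let x be the indicator of 2, and t
  = 1/(1+B). Then {2} is maximal with average (1+B)t, and B is arbitrary. The witness is the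
  doubling constant.\<close>

theorem theorem3p1:
  fixes p :: real
  assumes "1 \<le> p"
  shows "\<exists>C :: ereal \<Rightarrow> real. \<forall>\<omega> \<in> Ap_weights p. \<forall>x \<in> weighted_l1 \<omega>.
    (\<forall>t > 0.
       countable (maximal_dyadic x \<omega> t) \<and>
       disjoint (maximal_dyadic x \<omega> t) \<and>
       (\<forall>I \<in> maximal_dyadic x \<omega> t.
          t < weighted_avg \<omega> x I \<and> weighted_avg \<omega> x I \<le> C (Ap_norm p \<omega>) * t) \<and>
       (\<forall>n. n \<notin> \<Union> (maximal_dyadic x \<omega> t) \<longrightarrow> \<bar>x n\<bar> \<le> t)) \<and>
    (\<forall>t1 t2. 0 < t2 \<and> t2 < t1 \<longrightarrow>
       (\<forall>I \<in> maximal_dyadic x \<omega> t1. \<exists>J \<in> maximal_dyadic x \<omega> t2. I \<subseteq> J))"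
proof (intro exI[of _ "\<lambda>K. 2 powr p * real_of_ereal K"] ballI conjI allI impI)
  fix \<omega> x assume \<omega>: "\<omega> \<in> Ap_weights p" and x: "x \<in> weighted_l1 \<omega>"
  have w: "discrete_weight \<omega>" using \<omega> by (simp add: Ap_weights_def)
  note D = Ap_imp_dyadic_doubling[OF assms \<omega>]
  {
    fix t :: real assume t: "0 < t"
    show "countable (maximal_dyadic x \<omega> t)"
      by (rule countable_subset[OF _ countable_dyadic_intervals])
         (auto simp: maximal_dyadic_def large_dyadic_def)
    show "disjoint (maximal_dyadic x \<omega> t)" by (rule disjoint_maximal_dyadic)
    show "\<bar>x n\<bar> \<le> t" if "n \<notin> \<Union> (maximal_dyadic x \<omega> t)" for n
      using abs_le_outside_maximal[OF w D x t that] .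
    fix I assume I: "I \<in> maximal_dyadic x \<omega> t"
    show "t < weighted_avg \<omega> x I" using I by (simp add: maximal_dyadic_def large_dyadic_def)
    show "weighted_avg \<omega> x I \<le> 2 powr p * real_of_ereal (Ap_norm p \<omega>) * t"
      using weighted_avg_maximal_le[OF w D t I] .
  }
  fix t1 t2 I assume t: "0 < t2 \<and> t2 < t1" and "I \<in> maximal_dyadic x \<omega> t1"
  \<comment> \<open>Lowering the threshold keeps \<open>I\<close> large, though perhaps no longer
    maximal.\<close>
  hence "I \<in> large_dyadic x \<omega> t2" by (auto simp: maximal_dyadic_def large_dyadic_def)
  with t show "\<exists>J \<in> maximal_dyadic x \<omega> t2. I \<subseteq> J"
    using large_dyadic_subset_maximal[OF w D x] by metis
qed

end
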